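(* Let $n,c$ be positive integers and $a\in\{1,\dots,c\}$. Then $$\left|\Pi_n^{eq}\wr C_c(1^a2^a1^a)\right|=B(n)(c-1)^n+\sum_{i=1}^n\sum_{r=1}^i\binom{n}{i}\binom{i}{r}B(n-i)(c-1)^{n-r}$$ $$+\sum_{i=2}^n\sum_{\ell=2}^i\sum_{j=0}^{n-i}\binom{n}{i}\binom{i-1}{\ell-1}\binom{n-i}{j}\ell^jB(n-i-j)(c-1)^{n-i}.$$
   Context: $\Pi_n\wr C_c$ is the set of colored set partitions of $[n]$: a set partition of $[n]$ together with a color in $\{1,\dots,c\}$ for each element. A colored partition eq-contains $1^a2^a1^a$ iff there are elements $x<y<z$, all colored $a$, with $x$ and $z$ in the same block and $y$ in a different block; $\Pi_n^{eq}\wr C_c(1^a2^a1^a)$ is the set of those that do not. $B(m)$ is the $m$-th Bell number. *)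

theory Defs
  imports "HOL-Library.Disjoint_Sets" "HOL-Library.FuncSet"
begin

definition Bell :: "nat \<Rightarrow> nat" where
  "Bell m = card {P. partition_on {1..m} P}"

text \<open>The colouring is taken extensionally (undefined outside \<open>{1..n}\<close>), so that
  distinct pairs are distinct coloured partitions.\<close>

definition colored_partitions :: "nat \<Rightarrow> nat \<Rightarrow> (nat set set \<times> (nat \<Rightarrow> nat)) set" where
  "colored_partitions n c = {P. partition_on {1..n} P} \<times> ({1..n} \<rightarrow>\<^sub>E {1..c})"

definition eq_contains_121 :: "nat \<Rightarrow> nat set set \<times> (nat \<Rightarrow> nat) \<Rightarrow> bool" where
  "eq_contains_121 a = (\<lambda>(P, col).
     \<exists>A\<in>P. \<exists>B\<in>P. A \<noteq> B \<and>
       (\<exists>x\<in>A. \<exists>y\<in>B. \<exists>z\<in>A. x < y \<and> y < z \<and> col x = a \<and> col y = a \<and> col z = a))"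

definition eq_avoiders_121 :: "nat \<Rightarrow> nat \<Rightarrow> nat \<Rightarrow> (nat set set \<times> (nat \<Rightarrow> nat)) set" where
  "eq_avoiders_121 n c a = {\<pi> \<in> colored_partitions n c. \<not> eq_contains_121 a \<pi>}"

end

theory Submission
  imports Defs
begin

text \<open>
  Let \<open>S\<close> be the set of elements of colour \<open>a\<close>, with \<open>i\<close> elements. A coloured partition avoids
  the pattern iff its trace on \<open>S\<close> consists of intervals of \<open>S\<close>. An interval partition is determined
  by its block minima, an arbitrary subset of \<open>S\<close> containing \<open>Min S\<close>, so \<open>(i - 1) choose (l - 1)\<close> of
  them have \<open>l\<close> blocks. A partition with a given trace of \<open>l\<close> blocks arises by choosing the \<open>j\<close>
  further elements that join these blocks, distributing them in \<open>l ^ j\<close> ways, and partitioning the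
  remaining \<open>n - i - j\<close> elements arbitrarily. In the stated formula the terms for \<open>l = 1\<close>
  are indexed instead by the size of the single block containing \<open>S\<close>.
\<close>

section \<open>Sums over subsets by size, and Bell numbers of arbitrary finite sets\<close>

lemma sum_Pow_card:
  fixes g :: "nat \<Rightarrow> nat"
  assumes "finite A"
  shows "(\<Sum>S\<in>Pow A. g (card S)) = (\<Sum>i=0..card A. (card A choose i) * g i)"
proof -
  have "(\<Sum>S\<in>Pow A. g (card S)) = (\<Sum>i=0..card A. \<Sum>S\<in>{S \<in> Pow A. card S = i}. g (card S))"
    by (rule sum.group [symmetric]) (use assms in \<open>auto intro: card_mono\<close>)
  also have "\<dots> = (\<Sum>i=0..card A. (card A choose i) * g i)"
    using n_subsets [OF assms] by (intro sum.cong) (auto simp: Pow_def)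
  finally show ?thesis .
qed

text \<open>\<open>Bell\<close> refers to \<open>{1..m}\<close> only. A bijection \<open>h\<close>
  from \<open>A\<close> onto \<open>{1..card A}\<close> carries partitions over block by block, and
  \<open>inv_into A h\<close> carries them back.\<close>

lemma card_partition_on_eq_Bell:
  assumes "finite A"
  shows "card {P. partition_on A P} = Bell (card A)"
proof -
  obtain h where h: "bij_betw h A {1..card A}"
    using ex_bij_betw_finite_nat [OF assms] ex_bij_betw_nat_finite_1 [OF assms]
      bij_betw_inv by blast
  have inj: "inj_on h A" and im: "h ` A = {1..card A}"
    using h by (auto simp: bij_betw_def)
  have transport: "partition_on (f ` B) ((`) f ` P)" if "inj_on f B" "partition_on B P"
    for f :: "'x \<Rightarrow> 'y" and B P
  proof -
    \<comment> \<open>\<open>partition_on_inj_image\<close> discards a possible empty block of the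
      image; here there is none.\<close>
    have "(`) f ` P - {{}} = (`) f ` P"
      using that(2) by (auto simp: partition_on_def)
    then show ?thesis
      using partition_on_inj_image [OF that(2,1)] by simp
  qed
  let ?g = "inv_into A h"
  have g: "inj_on ?g {1..card A}" "?g ` {1..card A} = A"
    using bij_betw_inv_into [OF h] by (auto simp: bij_betw_def)
  have "bij_betw ((`) ((`) h)) {P. partition_on A P} {P. partition_on {1..card A} P}"
  proof (rule bij_betw_byWitness [where f' = "(`) ((`) ?g)"])
    show "\<forall>P\<in>{P. partition_on A P}. (`) ?g ` (`) h ` P = P"
    proof
      fix P assume "P \<in> {P. partition_on A P}"
      then have P: "partition_on A P" by simp
      have "?g ` h ` B = B" if "B \<in> P" for B
        using that P inj by (intro inv_into_image_cancel) (auto simp: partition_on_def)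
      then show "(`) ?g ` (`) h ` P = P"
        by (simp add: image_image cong: image_cong)
    qed
    show "\<forall>P\<in>{P. partition_on {1..card A} P}. (`) h ` (`) ?g ` P = P"
    proof
      fix P assume "P \<in> {P. partition_on {1..card A} P}"
      then have P: "partition_on {1..card A} P" by simp
      have "h ` ?g ` B = B" if "B \<in> P" for B
        using that P im by (intro image_inv_into_cancel [of _ A]) (auto simp: partition_on_def)
      then show "(`) h ` (`) ?g ` P = P"
        by (simp add: image_image cong: image_cong)
    qed
    show "(`) ((`) h) ` {P. partition_on A P} \<subseteq> {P. partition_on {1..card A} P}"
      using transport [OF inj] im by auto
    show "(`) ((`) ?g) ` {P. partition_on {1..card A} P} \<subseteq> {P. partition_on A P}"
      using transport [OF g(1)] g(2) by auto
  qed
  then show ?thesis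
    unfolding Bell_def by (rule bij_betw_same_card)
qed

section \<open>Partitions with a prescribed trace\<close>

definition trace :: "'a set \<Rightarrow> 'a set set \<Rightarrow> 'a set set" where
  "trace S P = (\<inter>) S ` P - {{}}"

lemma partition_on_trace:
  "partition_on A P \<Longrightarrow> S \<subseteq> A \<Longrightarrow> partition_on S (trace S P)"
  unfolding trace_def by (metis partition_on_restrict inf.absorb1)

text \<open>
  Here \<open>J\<close> is the set of elements outside \<open>S\<close> whose block meets \<open>S\<close>, \<open>f\<close> maps each of them to the
  trace of its block, and \<open>R\<close> consists of the blocks that miss \<open>S\<close>.
\<close>

lemma bij_betw_partitions_with_trace:
  assumes disj: "S \<inter> T = {}" and Q: "partition_on S Q"
  shows "bij_betw (\<lambda>(J, f, R). (\<lambda>q. q \<union> {x \<in> J. f x = q}) ` Q \<union> R)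
    (SIGMA J:Pow T. (J \<rightarrow>\<^sub>E Q) \<times> {R. partition_on (T - J) R})
    {P. partition_on (S \<union> T) P \<and> trace S P = Q}"
    (is "bij_betw ?G ?D ?E")
proof -
  \<comment> \<open>\<open>H\<close> is the inverse map, read off from \<open>P\<close>. Exactly one
    block contains a given \<open>x\<close>, so the union over \<open>{B \<in> P. x \<in> B}\<close>
    is just that block.\<close>
  define JJ where "JJ P = T \<inter> \<Union>{B \<in> P. S \<inter> B \<noteq> {}}" for P
  define H where "H P = (JJ P, restrict (\<lambda>x. S \<inter> \<Union>{B \<in> P. x \<in> B}) (JJ P), {B \<in> P. S \<inter> B = {}})"
    for P
  have QS: "\<Union>Q = S" and Qne: "{} \<notin> Q" 
    and Qdisj: "\<And>q q'. q \<in> Q \<Longrightarrow> q' \<in> Q \<Longrightarrow> q \<noteq> q' \<Longrightarrow> q \<inter> q' = {}"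
    using Q by (auto simp: partition_on_def disjoint_def)
  have GE: "?G (J, f, R) \<in> ?E" and HG: "H (?G (J, f, R)) = (J, f, R)"
    if J: "J \<subseteq> T" and f: "f \<in> J \<rightarrow>\<^sub>E Q" and R: "partition_on (T - J) R" for J f R
  proof -
    \<comment> \<open>\<open>e q\<close> is the block that grows out of \<open>q\<close>. Only
      elements of \<open>T\<close> are added, so intersecting with \<open>S\<close> gives back
      \<open>q\<close>.\<close>
    define e where "e q = q \<union> {x \<in> J. f x = q}" for q
    have fQ: "f x \<in> Q" if "x \<in> J" for x using f that by auto
    have RT: "\<Union>R = T - J" and Rne: "{} \<notin> R"
      and Rdisj: "\<And>q q'. q \<in> R \<Longrightarrow> q' \<in> R \<Longrightarrow> q \<noteq> q' \<Longrightarrow> q \<inter> q' = {}"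
      using R by (auto simp: partition_on_def disjoint_def)
    have G: "?G (J, f, R) = e ` Q \<union> R" by (auto simp: e_def)
    have Se: "S \<inter> e q = q" if "q \<in> Q" for q
      using that QS J disj by (auto simp: e_def)
    have SR: "S \<inter> B = {}" if "B \<in> R" for B
      using that RT disj by auto
    have Ue: "\<Union>(e ` Q) = S \<union> J"
      using QS fQ by (auto simp: e_def)
    have edisj: "e q \<inter> e q' = {}" if "q \<in> Q" "q' \<in> Q" "q \<noteq> q'" for q q'
      using Qdisj [OF that] that QS J disj by (auto simp: e_def)
    have part: "partition_on (S \<union> T) (e ` Q \<union> R)"
    proof (rule partition_onI)
      show "\<Union>(e ` Q \<union> R) = S \<union> T" using Ue RT J by auto
      show "{} \<notin> e ` Q \<union> R" using Rne Qne by (auto simp: e_def)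
      have eR: "e q \<inter> B = {}" if "q \<in> Q" "B \<in> R" for q B
        using that Ue RT disj by blast
      show "disjnt p q" if "p \<in> e ` Q \<union> R" "q \<in> e ` Q \<union> R" "p \<noteq> q" for p q
        using that unfolding disjnt_def
      proof (elim UnE imageE)
        fix q1 q2 assume "p = e q1" "q1 \<in> Q" "q = e q2" "q2 \<in> Q"
        then show "p \<inter> q = {}" using edisj \<open>p \<noteq> q\<close> by blast
      qed (use eR Rdisj \<open>p \<noteq> q\<close> in \<open>simp_all add: Int_commute\<close>)
    qed
    have tr: "trace S (e ` Q \<union> R) = Q"
    proof -
      have "(\<inter>) S ` e ` Q = Q" using Se by (auto simp: image_iff)
      moreover have "(\<inter>) S ` R \<subseteq> {{}}" using SR by auto
      ultimately show ?thesis using Qne unfolding trace_def image_Un by blast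
    qed
    show "?G (J, f, R) \<in> ?E" unfolding G using part tr by simp
    have meet: "{B \<in> e ` Q \<union> R. S \<inter> B \<noteq> {}} = e ` Q"
      using Se SR Qne by auto
    have JJ: "JJ (e ` Q \<union> R) = J"
      unfolding JJ_def meet Ue using J disj by auto
    have "{B \<in> e ` Q \<union> R. S \<inter> B = {}} = R"
      using Se SR Qne by auto
    moreover have "restrict (\<lambda>x. S \<inter> \<Union>{B \<in> e ` Q \<union> R. x \<in> B}) J = f"
    proof
      fix x
      show "restrict (\<lambda>x. S \<inter> \<Union>{B \<in> e ` Q \<union> R. x \<in> B}) J x = f x"
      proof (cases "x \<in> J")
        case True
        have xS: "x \<notin> S" "x \<notin> \<Union>R" using True J disj RT by auto
        \<comment> \<open>An added element lies in the single enlarged block \<open>e (f x)\<close>,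
          whose trace is \<open>f x\<close>; this recovers \<open>f\<close>.\<close>
        have xe: "x \<in> e q \<longleftrightarrow> q = f x" if "q \<in> Q" for q
          using True xS QS that by (auto simp: e_def)
        have "{B \<in> e ` Q \<union> R. x \<in> B} = {e (f x)}"
          using xe xS fQ [OF True] by auto
        then show ?thesis using True Se fQ by simp
      next
        case False
        then show ?thesis using f by (auto simp: PiE_def extensional_def)
      qed
    qed
    ultimately show "H (?G (J, f, R)) = (J, f, R)"
      unfolding G H_def JJ by simp
  qed
  have HD: "H P \<in> ?D" and GH: "?G (H P) = P" if P: "partition_on (S \<union> T) P" and tr: "trace S P = Q" for P
  proof -
    have UP: "\<Union>P = S \<union> T" and Pne: "{} \<notin> P" 
      and Pdisj: "\<And>q q'. q \<in> P \<Longrightarrow> q' \<in> P \<Longrightarrow> q \<inter> q' \<noteq> {} \<Longrightarrow> q = q'"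
      using P by (auto simp: partition_on_def disjoint_def)
    have uni: "\<Union>{B' \<in> P. x \<in> B'} = B" if "B \<in> P" "x \<in> B" for x B
      using that Pdisj by blast
    have Q_eq: "Q = (\<inter>) S ` {B \<in> P. S \<inter> B \<noteq> {}}"
      using tr by (auto simp: trace_def)
    have fun_in: "restrict (\<lambda>x. S \<inter> \<Union>{B \<in> P. x \<in> B}) (JJ P) \<in> JJ P \<rightarrow>\<^sub>E Q"
    proof (rule restrict_PiE_iff [THEN iffD2], rule ballI)
      fix x assume "x \<in> JJ P"
      then obtain B where B: "B \<in> P" "S \<inter> B \<noteq> {}" "x \<in> B" unfolding JJ_def by auto
      show "S \<inter> \<Union>{B \<in> P. x \<in> B} \<in> Q"
        unfolding uni [OF B(1,3)] Q_eq using B by auto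
    qed
    have rest: "partition_on (T - JJ P) {B \<in> P. S \<inter> B = {}}"
    proof (rule partition_onI)
      show "\<Union>{B \<in> P. S \<inter> B = {}} = T - JJ P"
      proof (rule set_eqI)
        fix x
        show "x \<in> \<Union>{B \<in> P. S \<inter> B = {}} \<longleftrightarrow> x \<in> T - JJ P"
        proof
          assume "x \<in> \<Union>{B \<in> P. S \<inter> B = {}}"
          then obtain B where B: "B \<in> P" "S \<inter> B = {}" "x \<in> B" by auto
          then have "x \<in> T" using UP by auto
          moreover have "x \<notin> JJ P"
            using B Pdisj [of B] by (auto simp: JJ_def)
          ultimately show "x \<in> T - JJ P" by auto
        next
          assume x: "x \<in> T - JJ P"
          then obtain B where "B \<in> P" "x \<in> B" using UP by auto
          then show "x \<in> \<Union>{B \<in> P. S \<inter> B = {}}" using x by (auto simp: JJ_def)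
        qed
      qed
    qed (use Pne Pdisj in \<open>auto simp: disjnt_def\<close>)
    show "H P \<in> ?D" unfolding H_def using fun_in rest by (auto simp: JJ_def)
    have e: "(S \<inter> B) \<union> {x \<in> JJ P. restrict (\<lambda>x. S \<inter> \<Union>{B \<in> P. x \<in> B}) (JJ P) x = S \<inter> B} = B"
      if B: "B \<in> P" "S \<inter> B \<noteq> {}" for B
    proof -
      have iff: "restrict (\<lambda>x. S \<inter> \<Union>{B \<in> P. x \<in> B}) (JJ P) x = S \<inter> B \<longleftrightarrow> x \<in> B"
        if x: "x \<in> JJ P" for x
      proof -
        obtain B' where B': "B' \<in> P" "x \<in> B'" using x unfolding JJ_def by auto
        \<comment> \<open>Since \<open>S \<inter> B\<close> is nonempty, blocks with equal traces
          share an element and hence coincide.\<close>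
        have "S \<inter> B' = S \<inter> B \<longleftrightarrow> B' = B" using Pdisj [OF B'(1) B(1)] B(2) by auto
        also have "\<dots> \<longleftrightarrow> x \<in> B" using Pdisj [OF B'(1) B(1)] B'(2) by auto
        finally show ?thesis using x uni [OF B'] by simp
      qed
      have "B \<subseteq> S \<union> JJ P"
        using B UP by (auto simp: JJ_def)
      then show ?thesis using iff by (simp cong: conj_cong) blast
    qed
    show "?G (H P) = P"
      unfolding H_def Q_eq prod.case image_image using e by (force simp: image_iff)
  qed
  show ?thesis
  proof (rule bij_betw_byWitness [where f' = H])
    show "\<forall>d\<in>?D. H (?G d) = d" using HG by auto
    show "?G ` ?D \<subseteq> ?E" using GE by blast
    show "\<forall>P\<in>?E. ?G (H P) = P" by (intro ballI, elim CollectE conjE) (rule GH)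
    show "H ` ?E \<subseteq> ?D" by (intro image_subsetI, elim CollectE conjE) (rule HD)
  qed
qed

text \<open>For fixed \<open>J\<close> there are \<open>card Q ^ card J\<close> maps and
  \<open>Bell (card T - card J)\<close> partitions of the rest. Both depend only on the size of
  \<open>J\<close>, so the sum over subsets becomes a sum over \<open>j\<close>.\<close>

lemma card_partitions_with_trace:
  assumes "finite S" "finite T" and "S \<inter> T = {}" and "partition_on S Q"
  shows "card {P. partition_on (S \<union> T) P \<and> trace S P = Q} =
    (\<Sum>j=0..card T. (card T choose j) * (card Q ^ j * Bell (card T - j)))"
proof -
  have finQ: "finite Q" using assms finite_elements by blast
  have "card {P. partition_on (S \<union> T) P \<and> trace S P = Q} =
      card (SIGMA J:Pow T. (J \<rightarrow>\<^sub>E Q) \<times> {R. partition_on (T - J) R})"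
    using bij_betw_same_card [OF bij_betw_partitions_with_trace [OF assms(3,4)]] by simp
  also have "\<dots> = (\<Sum>J\<in>Pow T. card ((J \<rightarrow>\<^sub>E Q) \<times> {R. partition_on (T - J) R}))"
    using assms finQ
    by (intro card_SigmaI ballI) (auto intro!: finite_PiE finitely_many_partition_on intro: finite_subset)
  also have "\<dots> = (\<Sum>J\<in>Pow T. card Q ^ card J * Bell (card T - card J))"
  proof (rule sum.cong [OF refl])
    fix J assume "J \<in> Pow T"
    then have "J \<subseteq> T" "finite J" using assms finite_subset by auto
    then show "card ((J \<rightarrow>\<^sub>E Q) \<times> {R. partition_on (T - J) R}) = card Q ^ card J * Bell (card T - card J)"
      using assms by (simp add: card_cartesian_product card_PiE card_partition_on_eq_Bell card_Diff_subset)
  qed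
  finally show ?thesis
    using sum_Pow_card [OF assms(2), of "\<lambda>j. card Q ^ j * Bell (card T - j)"] by simp
qed

section \<open>Interval partitions and their block minima\<close>

text \<open>Convexity is relative to \<open>S\<close>: gaps between elements of \<open>S\<close> do
  not matter. For finite \<open>S\<close> these partitions correspond to the compositions of
  \<open>card S\<close>.\<close>

definition interval_partition :: "'a::linorder set \<Rightarrow> 'a set set \<Rightarrow> bool" where
  "interval_partition S P \<longleftrightarrow> partition_on S P \<and>
     (\<forall>A\<in>P. \<forall>x\<in>A. \<forall>z\<in>A. \<forall>y\<in>S. x < y \<and> y < z \<longrightarrow> y \<in> A)"

text \<open>A block runs from its minimum up to the next larger block minimum. Thus the set of
  minima determines the whole partition.\<close>

lemma interval_partition_block_eq:
  fixes S :: "'a::linorder set"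
  assumes fin: "finite S" and P: "interval_partition S P" and A: "A \<in> P"
  shows "A = {x \<in> S. Min A \<le> x \<and> (\<forall>m\<in>Min ` P. m \<le> x \<longrightarrow> m \<le> Min A)}"
proof -
  have UP: "\<Union>P = S" and disj: "\<And>B B' x. B \<in> P \<Longrightarrow> B' \<in> P \<Longrightarrow> x \<in> B \<Longrightarrow> x \<in> B' \<Longrightarrow> B = B'"
    using P by (auto simp: interval_partition_def partition_on_def disjoint_def)
  have conv: "y \<in> B" if "B \<in> P" "x \<in> B" "z \<in> B" "y \<in> S" "x \<le> y" "y \<le> z" for B x y z
    using P that unfolding interval_partition_def by (metis order_le_less)
  have finB: "finite B" if "B \<in> P" for B
    using fin UP that by (metis Union_upper finite_subset)
  have MinB: "Min B \<in> B" if "B \<in> P" for B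
    using that finB P by (intro Min_in) (auto simp: interval_partition_def partition_on_def)
  show ?thesis
  proof (intro equalityI subsetI)
    fix x assume x: "x \<in> A"
    have "Min B \<le> Min A" if B: "B \<in> P" "Min B \<le> x" for B
    proof (rule ccontr)
      assume less: "\<not> Min B \<le> Min A"
      \<comment> \<open>If \<open>Min A < Min B \<le> x\<close>, then convexity of \<open>A\<close>
        puts \<open>Min B\<close> into \<open>A\<close>, and the two blocks coincide.\<close>
      have "Min B \<in> S" using MinB B UP by blast
      then have "Min B \<in> A"
        using conv [OF A MinB [OF A] x] B less by simp
      then have "B = A" using disj MinB A B by blast
      then show False using less by simp
    qed
    then show "x \<in> {x \<in> S. Min A \<le> x \<and> (\<forall>m\<in>Min ` P. m \<le> x \<longrightarrow> m \<le> Min A)}"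
      using x A UP finB by auto
  next
    fix x assume x: "x \<in> {x \<in> S. Min A \<le> x \<and> (\<forall>m\<in>Min ` P. m \<le> x \<longrightarrow> m \<le> Min A)}"
    then obtain B where B: "B \<in> P" "x \<in> B" using UP by auto
    \<comment> \<open>\<open>Min B\<close> is a block minimum not exceeding \<open>x\<close>, so the
      assumption on \<open>x\<close> applies to it. Then \<open>Min A\<close> lies between
      \<open>Min B\<close> and \<open>x\<close>, hence in \<open>B\<close>.\<close>
    then have "Min B \<le> Min A" using x finB by auto
    moreover have "Min A \<in> S" using MinB A UP by blast
    ultimately have "Min A \<in> B" using conv [OF B(1) MinB [OF B(1)] B(2)] x by simp
    then show "x \<in> A" using disj A B MinB by blast
  qed
qed

text \<open>The inverse map cuts \<open>S\<close> immediately before each element of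
  \<open>M\<close>. The set \<open>M\<close> has to contain \<open>Min S\<close>, or the elements
  below the first cut would belong to no block.\<close>

lemma bij_betw_interval_partitions_minima:
  fixes S :: "'a::linorder set"
  assumes fin: "finite S" and ne: "S \<noteq> {}"
  shows "bij_betw ((`) Min) {P. interval_partition S P} {M. Min S \<in> M \<and> M \<subseteq> S}"
proof -
  \<comment> \<open>This is the formula of \<open>interval_partition_block_eq\<close> with an
    arbitrary set \<open>M\<close> in the role of the set of minima.\<close>
  define b where "b M m = {x \<in> S. m \<le> x \<and> (\<forall>m'\<in>M. m' \<le> x \<longrightarrow> m' \<le> m)}" for M m
  have min_b: "Min (b M m) = m" and m_in: "m \<in> b M m" if "M \<subseteq> S" "m \<in> M" for M m
  proof -
    show "m \<in> b M m" using that by (auto simp: b_def)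
    then show "Min (b M m) = m" using fin by (intro Min_eqI) (auto simp: b_def)
  qed
  show ?thesis
  proof (rule bij_betw_byWitness [where f' = "\<lambda>M. b M ` M"])
    show "\<forall>P\<in>{P. interval_partition S P}. b (Min ` P) ` Min ` P = P"
    proof
      fix P assume "P \<in> {P. interval_partition S P}"
      then have P: "interval_partition S P" by simp
      have "b (Min ` P) (Min A) = A" if "A \<in> P" for A
        using interval_partition_block_eq [OF fin P that] unfolding b_def by simp
      then show "b (Min ` P) ` Min ` P = P"
        by (simp add: image_image cong: image_cong)
    qed
    show "\<forall>M\<in>{M. Min S \<in> M \<and> M \<subseteq> S}. Min ` b M ` M = M"
      using min_b by (simp add: image_image cong: image_cong)
    show "(`) Min ` {P. interval_partition S P} \<subseteq> {M. Min S \<in> M \<and> M \<subseteq> S}"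
    proof safe
      fix P assume "interval_partition S P"
      then have UP: "\<Union>P = S" and Pne: "{} \<notin> P"
        by (auto simp: interval_partition_def partition_on_def)
      have finB: "finite B" if "B \<in> P" for B
        using fin UP that by (metis Union_upper finite_subset)
      obtain B where B: "B \<in> P" "Min S \<in> B" using Min_in [OF fin ne] UP by auto
      have "Min B = Min S"
      proof (rule Min_eqI)
        show "Min S \<le> y" if "y \<in> B" for y
          using that B(1) UP fin by (intro Min_le) blast+
      qed (use B finB in auto)
      then show "Min S \<in> Min ` P" using B(1) by (metis image_eqI)
      show "Min B \<in> S" if "B \<in> P" for B
        using Min_in [of B] finB [OF that] that Pne UP by blast
    qed
    show "(\<lambda>M. b M ` M) ` {M. Min S \<in> M \<and> M \<subseteq> S} \<subseteq> {P. interval_partition S P}"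
    proof safe
      fix M assume M: "Min S \<in> M" "M \<subseteq> S"
      have "partition_on S (b M ` M)"
      proof (rule partition_onI)
        show "{} \<notin> b M ` M" using m_in [OF M(2)] by (metis empty_iff imageE)
        show "\<Union>(b M ` M) = S"
        proof (intro equalityI subsetI)
          fix x assume x: "x \<in> S"
          \<comment> \<open>The block of \<open>x\<close> starts at the largest element of
            \<open>M\<close> not exceeding \<open>x\<close>, which exists because
            \<open>Min S\<close> is in \<open>M\<close>.\<close>
          have f: "finite {m \<in> M. m \<le> x}" using finite_subset [OF M(2) fin] by simp
          have "{m \<in> M. m \<le> x} \<noteq> {}" using M x fin by auto
          then have "Max {m \<in> M. m \<le> x} \<in> {m \<in> M. m \<le> x}" using f by (rule Max_in [rotated])
          moreover have "\<forall>m'\<in>M. m' \<le> x \<longrightarrow> m' \<le> Max {m \<in> M. m \<le> x}" using f by auto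
          ultimately have "Max {m \<in> M. m \<le> x} \<in> M" "x \<in> b M (Max {m \<in> M. m \<le> x})"
            using x by (auto simp: b_def)
          then show "x \<in> \<Union>(b M ` M)" by blast
        qed (auto simp: b_def)
        show "disjnt p q" if "p \<in> b M ` M" "q \<in> b M ` M" "p \<noteq> q" for p q
        proof -
          obtain m m' where m: "m \<in> M" "m' \<in> M" "p = b M m" "q = b M m'"
            using \<open>p \<in> _\<close> \<open>q \<in> _\<close> by blast
          \<comment> \<open>Both \<open>m\<close> and \<open>m'\<close> are at most
            \<open>x\<close>, so membership of \<open>x\<close> in the two blocks bounds each by the
            other.\<close>
          have "m = m'" if "x \<in> b M m" "x \<in> b M m'" for x
            using that m(1,2) by (simp add: b_def order_antisym)
          then show ?thesis using m(3,4) \<open>p \<noteq> q\<close> by (auto simp: disjnt_def)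
        qed
      qed
      moreover have "y \<in> b M m" if "x \<in> b M m" "z \<in> b M m" "y \<in> S" "x < y" "y < z" for m x y z
        using that by (auto simp: b_def)
      ultimately show "interval_partition S (b M ` M)"
        unfolding interval_partition_def by blast
    qed
  qed
qed

lemma card_Min_image_interval_partition:
  fixes S :: "'a::linorder set"
  assumes "finite S" and "interval_partition S P"
  shows "card (Min ` P) = card P"
proof (rule card_image, rule inj_onI)
  fix A B assume "A \<in> P" "B \<in> P" "Min A = Min B"
  then show "A = B"
    using interval_partition_block_eq [OF assms, of A] interval_partition_block_eq [OF assms, of B]
    by simp
qed

text \<open>A partition into \<open>l\<close> blocks has \<open>l\<close> minima. One of them is
  \<open>Min S\<close>, and the other \<open>l - 1\<close> are chosen freely from the remaining
  \<open>card S - 1\<close> elements. The weight \<open>g\<close> will be the number of partitions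
  that extend a trace of \<open>l\<close> blocks.\<close>

lemma sum_interval_partitions_card:
  fixes S :: "'a::linorder set" and g :: "nat \<Rightarrow> nat"
  assumes fin: "finite S" and ne: "S \<noteq> {}"
  shows "(\<Sum>P | interval_partition S P. g (card P)) =
    (\<Sum>l=1..card S. ((card S - 1) choose (l - 1)) * g l)"
proof -
  have m: "Min S \<in> S" using assms by simp
  have "(\<Sum>P | interval_partition S P. g (card P)) =
      (\<Sum>P | interval_partition S P. g (card (Min ` P)))"
    using card_Min_image_interval_partition [OF fin] by (intro sum.cong) auto
  also have "\<dots> = (\<Sum>M\<in>{M. Min S \<in> M \<and> M \<subseteq> S}. g (card M))"
    by (rule sum.reindex_bij_betw [OF bij_betw_interval_partitions_minima [OF assms]])
  also have "\<dots> = (\<Sum>M\<in>Pow (S - {Min S}). g (Suc (card M)))"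
  proof (rule sum.reindex_bij_witness [where j = "\<lambda>M. M - {Min S}" and i = "insert (Min S)"])
    fix M assume "M \<in> {M. Min S \<in> M \<and> M \<subseteq> S}"
    then have "Min S \<in> M" "finite M" using fin finite_subset by auto
    then show "g (Suc (card (M - {Min S}))) = g (card M)"
      by (metis card_Suc_Diff1)
  qed (use m in auto)
  also have "\<dots> = (\<Sum>l=0..card S - 1. ((card S - 1) choose l) * g (Suc l))"
    using sum_Pow_card [of "S - {Min S}" "\<lambda>l. g (Suc l)"] fin m by simp
  also have "\<dots> = (\<Sum>l=1..card S. ((card S - 1) choose (l - 1)) * g l)"
  proof -
    have "card S > 0" using assms by (simp add: card_gt_0_iff)
    then show ?thesis
      by (intro sum.reindex_bij_witness [where j = Suc and i = "\<lambda>l. l - 1"]) auto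
  qed
  finally show ?thesis .
qed

section \<open>Pattern avoidance as a condition on the trace\<close>

text \<open>Blocks that miss \<open>S\<close> satisfy the condition vacuously, so it may range over
  all blocks of \<open>P\<close> although \<open>trace\<close> drops empty intersections.\<close>

lemma interval_partition_trace_iff:
  assumes "partition_on A P" and "S \<subseteq> A"
  shows "interval_partition S (trace S P) \<longleftrightarrow>
    (\<forall>B\<in>P. \<forall>x\<in>S \<inter> B. \<forall>z\<in>S \<inter> B. \<forall>y\<in>S. x < y \<and> y < z \<longrightarrow> y \<in> B)"
proof -
  have "interval_partition S (trace S P) \<longleftrightarrow>
      (\<forall>B\<in>trace S P. \<forall>x\<in>B. \<forall>z\<in>B. \<forall>y\<in>S. x < y \<and> y < z \<longrightarrow> y \<in> B)"
    using partition_on_trace [OF assms] by (simp add: interval_partition_def)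
  also have "\<dots> \<longleftrightarrow> (\<forall>B\<in>P. \<forall>x\<in>S \<inter> B. \<forall>z\<in>S \<inter> B. \<forall>y\<in>S. x < y \<and> y < z \<longrightarrow> y \<in> S \<inter> B)"
    by (simp add: trace_def Ball_def image_iff) blast
  finally show ?thesis by simp
qed

text \<open>Since the blocks are disjoint and cover \<open>{1..n}\<close>, an element
  \<open>y\<close> lies in a block other than \<open>A\<close> exactly when it is not in
  \<open>A\<close>. The pattern is therefore a failure of convexity within the colour class.\<close>

lemma eq_contains_121_iff:
  assumes P: "partition_on {1..n} P"
  shows "eq_contains_121 a (P, col) \<longleftrightarrow>
    \<not> interval_partition {x \<in> {1..n}. col x = a} (trace {x \<in> {1..n}. col x = a} P)"
    (is "_ \<longleftrightarrow> \<not> interval_partition ?S _")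
proof -
  have UP: "\<Union>P = {1..n}" and disj: "\<And>B B' x. B \<in> P \<Longrightarrow> B' \<in> P \<Longrightarrow> x \<in> B \<Longrightarrow> x \<in> B' \<Longrightarrow> B = B'"
    using P by (auto simp: partition_on_def disjoint_def)
  have S: "?S \<subseteq> {1..n}" by auto
  have "eq_contains_121 a (P, col) \<longleftrightarrow>
      (\<exists>A\<in>P. \<exists>x\<in>?S \<inter> A. \<exists>z\<in>?S \<inter> A. \<exists>y\<in>?S. x < y \<and> y < z \<and> y \<notin> A)"
  proof
    assume "eq_contains_121 a (P, col)"
    then obtain A B x y z where *: "A \<in> P" "B \<in> P" "A \<noteq> B" "x \<in> A" "y \<in> B" "z \<in> A"
      "x < y" "y < z" "col x = a" "col y = a" "col z = a"
      unfolding eq_contains_121_def by blast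
    then have "x \<in> ?S \<inter> A" "z \<in> ?S \<inter> A" "y \<in> ?S" "y \<notin> A" using UP disj by blast+
    then show "\<exists>A\<in>P. \<exists>x\<in>?S \<inter> A. \<exists>z\<in>?S \<inter> A. \<exists>y\<in>?S. x < y \<and> y < z \<and> y \<notin> A"
      using * by blast
  next
    assume "\<exists>A\<in>P. \<exists>x\<in>?S \<inter> A. \<exists>z\<in>?S \<inter> A. \<exists>y\<in>?S. x < y \<and> y < z \<and> y \<notin> A"
    then obtain A x y z where *: "A \<in> P" "x \<in> ?S \<inter> A" "z \<in> ?S \<inter> A" "y \<in> ?S" "x < y" "y < z" "y \<notin> A"
      by blast
    then obtain B where "B \<in> P" "y \<in> B" using UP by blast
    then show "eq_contains_121 a (P, col)"
      using * unfolding eq_contains_121_def by blast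
  qed
  also have "\<dots> \<longleftrightarrow> \<not> interval_partition ?S (trace ?S P)"
    unfolding interval_partition_trace_iff [OF P S] by blast
  finally show ?thesis .
qed

section \<open>Counting avoiders by their colour class\<close>

text \<open>Elements of \<open>S\<close> are forced to have colour \<open>a\<close>, and every other
  element chooses among the remaining \<open>c - 1\<close> colours. A dependent function space
  expresses these independent choices.\<close>

lemma card_colorings_with_color_class:
  assumes "a \<in> {1..c}" and S: "S \<subseteq> {1..n}"
  shows "card {col \<in> {1..n} \<rightarrow>\<^sub>E {1..c}. {x \<in> {1..n}. col x = a} = S} = (c - 1) ^ (n - card S)"
proof -
  have "{col \<in> {1..n} \<rightarrow>\<^sub>E {1..c}. {x \<in> {1..n}. col x = a} = S} =
      (\<Pi>\<^sub>E x\<in>{1..n}. if x \<in> S then {a} else {1..c} - {a})" (is "?L = ?R")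
  proof (intro equalityI subsetI)
    fix col assume "col \<in> ?L"
    then show "col \<in> ?R" by (auto simp: PiE_iff)
  next
    fix col assume col: "col \<in> ?R"
    then have *: "col x \<in> (if x \<in> S then {a} else {1..c} - {a})" if "x \<in> {1..n}" for x
      using that by (rule PiE_mem)
    have "{x \<in> {1..n}. col x = a} = S"
      using * S by (fastforce split: if_splits)
    moreover have "col \<in> {1..n} \<rightarrow>\<^sub>E {1..c}"
      using col * assms(1) by (fastforce simp: PiE_iff split: if_splits)
    ultimately show "col \<in> ?L" by simp
  qed
  also have "card \<dots> = (\<Prod>x\<in>{1..n}. if x \<in> S then 1 else c - 1)"
    using assms(1) by (simp add: card_PiE if_distrib cong: prod.cong if_cong)
  also have "\<dots> = (c - 1) ^ card ({1..n} - S)"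
    by (simp add: prod.If_cases Diff_eq)
  also have "card ({1..n} - S) = n - card S"
    using S by (simp add: card_Diff_subset finite_subset [OF S])
  finally show ?thesis .
qed

text \<open>The partitions are sorted by their trace \<open>Q\<close>, and each fibre is counted
  with \<open>T = A - S\<close>.\<close>

lemma card_partitions_interval_trace:
  fixes A :: "'a::linorder set"
  assumes fin: "finite A" and S: "S \<subseteq> A"
  shows "card {P. partition_on A P \<and> interval_partition S (trace S P)} =
    (\<Sum>Q | interval_partition S Q.
       \<Sum>j=0..card A - card S. ((card A - card S) choose j) * (card Q ^ j * Bell (card A - card S - j)))"
proof -
  have finS: "finite S" using assms finite_subset by blast
  have finA: "finite {P. partition_on A P \<and> trace S P = Q}" for Q
    by (rule finite_subset [OF _ finitely_many_partition_on [OF fin]]) auto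
  have finQ: "finite {Q. interval_partition S Q}"
    by (rule finite_subset [OF _ finitely_many_partition_on [OF finS]])
      (auto simp: interval_partition_def)
  have "{P. partition_on A P \<and> interval_partition S (trace S P)} =
      (\<Union>Q\<in>{Q. interval_partition S Q}. {P. partition_on A P \<and> trace S P = Q})"
    by auto
  also have "card \<dots> = (\<Sum>Q | interval_partition S Q. card {P. partition_on A P \<and> trace S P = Q})"
    using finA finQ by (intro card_UN_disjoint) auto
  also have "\<dots> = (\<Sum>Q | interval_partition S Q.
       \<Sum>j=0..card A - card S. ((card A - card S) choose j) * (card Q ^ j * Bell (card A - card S - j)))"
  proof (rule sum.cong [OF refl])
    fix Q assume "Q \<in> {Q. interval_partition S Q}"
    then have "partition_on S Q" by (simp add: interval_partition_def)
    moreover have "S \<union> (A - S) = A" using S by auto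
    ultimately show "card {P. partition_on A P \<and> trace S P = Q} = 
        (\<Sum>j=0..card A - card S. ((card A - card S) choose j) * (card Q ^ j * Bell (card A - card S - j)))"
      using card_partitions_with_trace [of S "A - S" Q] fin finS S
      by (simp add: card_Diff_subset)
  qed
  finally show ?thesis .
qed

text \<open>For a fixed colour class \<open>S\<close>, the partition and the colouring are chosen
  independently, and both counts depend only on \<open>card S\<close>. The terms for
  \<open>l = 1\<close> are still part of the triple sum.\<close>

lemma card_eq_avoiders_121:
  assumes a: "a \<in> {1..c}"
  shows "card (eq_avoiders_121 n c a) = Bell n * (c - 1) ^ n +
    (\<Sum>i=1..n. \<Sum>l=1..i. \<Sum>j=0..n - i.
         (n choose i) * ((i - 1) choose (l - 1)) * ((n - i) choose j) * l ^ j
           * Bell (n - i - j) * (c - 1) ^ (n - i))"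
proof -
  define X where "X S = {P. partition_on {1..n} P \<and> interval_partition S (trace S P)}" for S
  define C where "C S = {col \<in> {1..n} \<rightarrow>\<^sub>E {1..c}. {x \<in> {1..n}. col x = a} = S}" for S
  \<comment> \<open>The case \<open>i = 0\<close> is separate: the empty trace has no blocks, so the
    sum from \<open>l = 1\<close> would give 0, whereas every partition qualifies.\<close>
  define w where "w i = (if i = 0 then Bell n else
    \<Sum>l=1..i. ((i - 1) choose (l - 1)) *
       (\<Sum>j=0..n - i. ((n - i) choose j) * (l ^ j * Bell (n - i - j))))" for i
  have finX: "finite (X S)" for S
    by (rule finite_subset [OF _ finitely_many_partition_on [of "{1..n}"]]) (auto simp: X_def)
  have finC: "finite (C S)" for S
    by (rule finite_subset [of _ "{1..n} \<rightarrow>\<^sub>E {1..c}"]) (auto simp: C_def intro: finite_PiE)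
  have cardX: "card (X S) = w (card S)" if S: "S \<subseteq> {1..n}" for S
  proof (cases "S = {}")
    case True
    have "X {} = {P. partition_on {1..n} P}"
      by (auto simp: X_def trace_def interval_partition_def partition_on_empty)
    then show ?thesis using True by (simp add: w_def Bell_def)
  next
    case False
    have finS: "finite S" using S finite_subset by blast
    then show ?thesis
      using False card_partitions_interval_trace [OF _ S]
        sum_interval_partitions_card [OF finS False, of "\<lambda>l. \<Sum>j=0..n - card S.
          ((n - card S) choose j) * (l ^ j * Bell (n - card S - j))"]
      by (simp add: X_def w_def)
  qed
  have "eq_avoiders_121 n c a = (\<Union>S\<in>Pow {1..n}. X S \<times> C S)"
    unfolding eq_avoiders_121_def colored_partitions_def X_def C_def
    by (auto simp: eq_contains_121_iff)
  also have "card \<dots> = (\<Sum>S\<in>Pow {1..n}. card (X S \<times> C S))"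
    \<comment> \<open>The union is disjoint because a colouring determines its class
      \<open>S\<close>.\<close>
    using finX finC by (intro card_UN_disjoint) (auto simp: C_def)
  also have "\<dots> = (\<Sum>S\<in>Pow {1..n}. w (card S) * (c - 1) ^ (n - card S))"
    using cardX card_colorings_with_color_class [OF a]
    by (intro sum.cong) (auto simp: card_cartesian_product C_def)
  also have "\<dots> = (\<Sum>i=0..n. (n choose i) * (w i * (c - 1) ^ (n - i)))"
    using sum_Pow_card [of "{1..n}" "\<lambda>i. w i * (c - 1) ^ (n - i)"] by simp
  also have "\<dots> = Bell n * (c - 1) ^ n + (\<Sum>i=1..n. (n choose i) * (w i * (c - 1) ^ (n - i)))"
    by (simp add: sum.atLeast_Suc_atMost w_def)
  also have "(\<Sum>i=1..n. (n choose i) * (w i * (c - 1) ^ (n - i))) =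
    (\<Sum>i=1..n. \<Sum>l=1..i. \<Sum>j=0..n - i.
         (n choose i) * ((i - 1) choose (l - 1)) * ((n - i) choose j) * l ^ j
           * Bell (n - i - j) * (c - 1) ^ (n - i))"
    by (intro sum.cong refl) (simp add: w_def sum_distrib_left sum_distrib_right mult_ac)
  finally show ?thesis .
qed

section \<open>Regrouping the traces with a single block\<close>

text \<open>Choosing \<open>r\<close> elements and then \<open>j\<close> further ones amounts to
  choosing \<open>i = r + j\<close> elements and then \<open>r\<close> among them. In the
  application \<open>r\<close> is the size of the colour class and \<open>i\<close> that of the
  block containing it.\<close>

lemma sum_choose_choose_reindex:
  fixes f :: "nat \<Rightarrow> nat \<Rightarrow> nat"
  shows "(\<Sum>r=1..n. \<Sum>j=0..n - r. (n choose r) * ((n - r) choose j) * f r (r + j)) =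
    (\<Sum>i=1..n. \<Sum>r=1..i. (n choose i) * (i choose r) * f r i)"
proof -
  have "(\<Sum>r=1..n. \<Sum>j=0..n - r. (n choose r) * ((n - r) choose j) * f r (r + j)) =
      (\<Sum>(r, j)\<in>(SIGMA r:{1..n}. {0..n - r}). (n choose r) * ((n - r) choose j) * f r (r + j))"
    by (rule sum.Sigma) auto
  also have "\<dots> = (\<Sum>(i, r)\<in>(SIGMA i:{1..n}. {1..i}). (n choose i) * (i choose r) * f r i)"
  proof (rule sum.reindex_bij_witness
      [where j = "\<lambda>(r, j). (r + j, r)" and i = "\<lambda>(i, r). (r, i - r)"])
    fix p assume "p \<in> (SIGMA r:{1..n}. {0..n - r})"
    then obtain r j where "p = (r, j)" "r + j \<le> n" by auto
    then show "(case case p of (r, j) \<Rightarrow> (r + j, r) of (i, r) \<Rightarrow> (n choose i) * (i choose r) * f r i) =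
      (case p of (r, j) \<Rightarrow> (n choose r) * (n - r choose j) * f r (r + j))"
      using choose_mult [of r "r + j" n] by simp
  qed auto
  also have "\<dots> = (\<Sum>i=1..n. \<Sum>r=1..i. (n choose i) * (i choose r) * f r i)"
    by (rule sum.Sigma [symmetric]) auto
  finally show ?thesis .
qed

theorem theorem5p4:
  fixes n c a :: nat
  assumes "n \<ge> 1" and "c \<ge> 1" and "a \<in> {1..c}"
  shows "card (eq_avoiders_121 n c a) =
      Bell n * (c - 1) ^ n
    + (\<Sum>i=1..n. \<Sum>r=1..i. (n choose i) * (i choose r) * Bell (n - i) * (c - 1) ^ (n - r))
    + (\<Sum>i=2..n. \<Sum>l=2..i. \<Sum>j=0..n - i.
         (n choose i) * ((i - 1) choose (l - 1)) * ((n - i) choose j) * l ^ j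
           * Bell (n - i - j) * (c - 1) ^ (n - i))"
proof -
  \<comment> \<open>\<open>t i l\<close> is the contribution of colour classes of size
    \<open>i\<close> whose trace has \<open>l\<close> blocks.\<close>
  define t where "t i l = (\<Sum>j=0..n - i.
         (n choose i) * ((i - 1) choose (l - 1)) * ((n - i) choose j) * l ^ j
           * Bell (n - i - j) * (c - 1) ^ (n - i))" for i l
  have "(\<Sum>i=1..n. \<Sum>l=1..i. t i l) = (\<Sum>i=1..n. t i 1 + (\<Sum>l=2..i. t i l))"
    by (intro sum.cong refl) (simp add: sum.atLeast_Suc_atMost numeral_2_eq_2)
  also have "\<dots> = (\<Sum>i=1..n. t i 1) + (\<Sum>i=2..n. \<Sum>l=2..i. t i l)"
  proof -
    \<comment> \<open>For \<open>i = 1\<close> the range \<open>{2..i}\<close> is empty, so the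
      outer sum may start at 2.\<close>
    have "(\<Sum>i=1..n. \<Sum>l=2..i. t i l) = (\<Sum>i=2..n. \<Sum>l=2..i. t i l)"
      by (rule sum.mono_neutral_right) auto
    then show ?thesis by (simp add: sum.distrib)
  qed
  \<comment> \<open>For \<open>l = 1\<close> both \<open>l ^ j\<close> and
    \<open>(i - 1) choose (l - 1)\<close> equal 1.\<close>
  also have "(\<Sum>i=1..n. t i 1) =
      (\<Sum>r=1..n. \<Sum>j=0..n - r. (n choose r) * ((n - r) choose j) * (Bell (n - (r + j)) * (c - 1) ^ (n - r)))"
    by (simp add: t_def mult_ac)
  also have "\<dots> = (\<Sum>i=1..n. \<Sum>r=1..i. (n choose i) * (i choose r) * Bell (n - i) * (c - 1) ^ (n - r))"
    using sum_choose_choose_reindex [of n "\<lambda>r i. Bell (n - i) * (c - 1) ^ (n - r)"]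
    by (simp add: mult_ac)
  finally show ?thesis
    unfolding card_eq_avoiders_121 [OF assms(3)] t_def by simp
qed

end
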